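(* Let $F=f+\psi:\mathbb{R}^n\to\mathbb{R}\cup\{+\infty\}$, the sampling $\hat S$ and the vector $v$ be as in the context; in particular $F$ satisfies the local quadratic error bound and $(f,\hat S)\sim \mathrm{ESO}(v)$. Let $x_0\in\operatorname{dom}\psi$, let $\theta_0=\tau/n$, let $\alpha\in(0,1)$, and define $$K(\alpha)=\left\lceil \frac{2}{\theta_0}\left(\sqrt{\frac{1+\mu(v,x_0)}{\alpha\,\mu(v,x_0)}}-1\right)+1\right\rceil .$$ Run APPROX with restart and guaranteed function value decrease from $x_0$ with all restart periods equal, $K_r=K(\alpha)$ for every $r\ge 0$. Then its iterates $(\tilde x_r)_{r\ge0}$ satisfy, for all $r\ge 0$, $$\mathbf{E}[F(\tilde x_r)-F^*]\le \alpha^r\,(F(x_0)-F^* ).$$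
   Context: Problem. $F(x)=f(x)+\psi(x)$ on $\mathbb{R}^n$, where $f:\mathbb{R}^n\to\mathbb{R}$ is convex and differentiable and $\psi(x)=\sum_{i=1}^n\psi^i(x^i)$ with each $\psi^i:\mathbb{R}\to\mathbb{R}\cup\{+\infty\}$ closed, proper and convex. $F^*$ is the minimum value of $F$ and $\mathcal{X}^*$ the set of minimizers, assumed nonempty. For a vector $v\in\mathbb{R}^n$ with positive entries, $\|x\|_v^2=\sum_i v_i(x^i)^2$ and $\operatorname{dist}_v(x,\mathcal{X}^* )$ is the distance to $\mathcal{X}^*$ in the norm $\|\cdot\|_v$. Local quadratic error bound (assumed): for every $x_0\in\operatorname{dom}(F)$ there is $\mu>0$ such that $F(x)\ge F^*+\frac{\mu}{2}\operatorname{dist}_v(x,\mathcal{X}^* )^2$ for all $x$ with $F(x)\le F(x_0)$. $\mu(v,x_0)$ denotes the largest such $\mu$ (if $x_0\in\mathcal{X}^*$, $\mu(v,x_0)=+\infty$, with the conventions $1/\mu=0$ and $(1+\mu)/\mu=1$). Sampling and ESO. $\hat S$ is a random subset of $\{1,\dots,n\}$ with $\mathbf{P}(i\in\hat S)=\mathbf{P}(j\in\hat S)$ for all $i,j$, and $\tau=\mathbf{E}[|\hat S|]>0$. For $h\in\mathbb{R}^n$, $h_{[S]}=\sum_{i\in S}h^ie_i$. $(f,\hat S)\sim\mathrm{ESO}(v)$ means: for all $x,h\in\mathbb{R}^n$, $\mathbf{E}[f(x+h_{[\hat S]})]\le f(x)+\frac{\tau}{n}\big(\langle\nabla f(x),h\rangle+\frac12\|h\|_v^2\big)$.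 APPROX$(f,\psi,x_0,K)$: set $\theta_0=\tau/n$, $z_0=x_0$. For $k=0,\dots,K-1$: $y_k=(1-\theta_k)x_k+\theta_kz_k$; draw $S_k$ distributed as $\hat S$, independently of the past; for $i\in S_k$ set $z_{k+1}^i=\arg\min_{z\in\mathbb{R}}\{\nabla_if(y_k)(z-y_k^i)+\frac{\theta_knv_i}{2\tau}|z-z_k^i|^2+\psi^i(z)\}$, and $z_{k+1}^i=z_k^i$ for $i\notin S_k$; $x_{k+1}=y_k+\frac n\tau\theta_k(z_{k+1}-z_k)$; $\theta_{k+1}=\frac{\sqrt{\theta_k^4+4\theta_k^2}-\theta_k^2}{2}$. Return $x_K$. APPROX with restart and guaranteed function value decrease: set $\tilde x_0=x_0$. For $r\ge 0$: $\bar x_{r+1}=$ APPROX$(f,\psi,\tilde x_r,K_r)$ (run with fresh independent randomness); $\tilde x_{r+1}=\bar x_{r+1}$ if $F(\bar x_{r+1})\le F(\tilde x_r)$ and $\tilde x_{r+1}=\tilde x_r$ otherwise. *)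

theory Defs
  imports "HOL-Probability.Probability"
begin

section \<open>Composite convex problems\<close>

definition ereal_epigraph :: "('a \<Rightarrow> ereal) \<Rightarrow> ('a \<times> real) set" where
  "ereal_epigraph g = {(x, t). g x \<le> ereal t}"

definition closed_proper_convex :: "(real \<Rightarrow> ereal) \<Rightarrow> bool" where
  "closed_proper_convex g \<longleftrightarrow>
     closed (ereal_epigraph g) \<and> convex (ereal_epigraph g) \<and>
     (\<forall>x. g x \<noteq> -\<infinity>) \<and> (\<exists>x. g x \<noteq> \<infinity>)"

definition separable :: "('n \<Rightarrow> real \<Rightarrow> ereal) \<Rightarrow> real^'n::finite \<Rightarrow> ereal" where
  "separable \<psi> x = (\<Sum>i\<in>UNIV. \<psi> i (x $ i))"

definition objective ::
  "(real^'n::finite \<Rightarrow> real) \<Rightarrow> ('n \<Rightarrow> real \<Rightarrow> ereal) \<Rightarrow> real^'n \<Rightarrow> ereal" where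
  "objective f \<psi> x = ereal (f x) + separable \<psi> x"

definition eff_dom :: "('a \<Rightarrow> ereal) \<Rightarrow> 'a set" where
  "eff_dom g = {x. g x < \<infinity>}"

definition min_value :: "('a \<Rightarrow> ereal) \<Rightarrow> ereal" where
  "min_value F = (INF x. F x)"

definition minimizers :: "('a \<Rightarrow> ereal) \<Rightarrow> 'a set" where
  "minimizers F = {x. \<forall>y. F x \<le> F y}"

definition gradient :: "(real^'n::finite \<Rightarrow> real) \<Rightarrow> real^'n \<Rightarrow> real^'n" where
  "gradient f x = (THE D. GDERIV f x :> D)"

section \<open>Weighted norm and the local quadratic error bound\<close>

definition wnorm :: "real^'n::finite \<Rightarrow> real^'n \<Rightarrow> real" where
  "wnorm v x = sqrt (\<Sum>i\<in>UNIV. v $ i * (x $ i)\<^sup>2)"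

definition wdist :: "real^'n::finite \<Rightarrow> real^'n \<Rightarrow> (real^'n) set \<Rightarrow> real" where
  "wdist v x A = (INF y\<in>A. wnorm v (x - y))"

definition quadratic_error_bound ::
  "(real^'n::finite \<Rightarrow> ereal) \<Rightarrow> real^'n \<Rightarrow> real^'n \<Rightarrow> real \<Rightarrow> bool" where
  "quadratic_error_bound F v x0 \<mu> \<longleftrightarrow>
     (\<forall>x. F x \<le> F x0 \<longrightarrow>
        F x \<ge> min_value F + ereal (\<mu> / 2 * (wdist v x (minimizers F))\<^sup>2))"

definition local_quadratic_error_bound ::
  "(real^'n::finite \<Rightarrow> ereal) \<Rightarrow> real^'n \<Rightarrow> bool" where
  "local_quadratic_error_bound F v \<longleftrightarrow>
     (\<forall>x0\<in>eff_dom F. \<exists>\<mu>>0. quadratic_error_bound F v x0 \<mu>)"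

text \<open>
  The largest constant in the error bound on the level set of \<open>x0\<close>.  When it is finite the
  supremum is attained (\<open>quadratic_error_bound_error_bound_const\<close> below), so it is a maximum;
  for a minimizer \<open>x0\<close> it equals \<open>\<infinity>\<close> (\<open>error_bound_const_minimizer\<close>).
\<close>

definition error_bound_const :: "(real^'n::finite \<Rightarrow> ereal) \<Rightarrow> real^'n \<Rightarrow> real^'n \<Rightarrow> ereal" where
  "error_bound_const F v x0 = Sup (ereal ` {\<mu>. \<mu> > 0 \<and> quadratic_error_bound F v x0 \<mu>})"

text \<open>
  The quotient \<open>(1 + \<mu>) / \<mu>\<close> with value \<open>1\<close> at \<open>\<mu> = \<infinity>\<close>; ereal division would give
  \<open>\<infinity> / \<infinity> = 0\<close> instead.
\<close>

definition one_plus_over :: "ereal \<Rightarrow> real" where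
  "one_plus_over \<mu> =
     (if \<mu> = \<infinity> then 1 else (1 + real_of_ereal \<mu>) / real_of_ereal \<mu>)"

section \<open>Samplings and expected separable overapproximation\<close>

text \<open>
  A sampling enters only through its law, a probability mass function on the (finite) type of
  subsets of the coordinate set.
\<close>

definition uniform_sampling :: "'n::finite set pmf \<Rightarrow> bool" where
  "uniform_sampling S \<longleftrightarrow>
     (\<forall>i j. measure_pmf.prob S {A. i \<in> A} = measure_pmf.prob S {A. j \<in> A})"

definition avg_size :: "'n::finite set pmf \<Rightarrow> real" where
  "avg_size S = measure_pmf.expectation S (\<lambda>A. real (card A))"

definition restrict_vec :: "real^'n::finite \<Rightarrow> 'n set \<Rightarrow> real^'n" where
  "restrict_vec h A = (\<Sum>i\<in>A. h $ i *\<^sub>R axis i 1)"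

definition ESO ::
  "(real^'n::finite \<Rightarrow> real) \<Rightarrow> 'n set pmf \<Rightarrow> real^'n \<Rightarrow> bool" where
  "ESO f S v \<longleftrightarrow>
     (\<forall>x h. measure_pmf.expectation S (\<lambda>A. f (x + restrict_vec h A))
        \<le> f x + avg_size S / real CARD('n) * (gradient f x \<bullet> h + (wnorm v h)\<^sup>2 / 2))"

section \<open>APPROX, without and with restart\<close>

primrec theta :: "real \<Rightarrow> nat \<Rightarrow> real" where
  "theta \<theta>0 0 = \<theta>0"
| "theta \<theta>0 (Suc k) =
     (sqrt (theta \<theta>0 k ^ 4 + 4 * (theta \<theta>0 k)\<^sup>2) - (theta \<theta>0 k)\<^sup>2) / 2"

definition coord_prox ::
  "(real^'n::finite \<Rightarrow> real) \<Rightarrow> ('n \<Rightarrow> real \<Rightarrow> ereal) \<Rightarrow> real^'n \<Rightarrow> real \<Rightarrow> real \<Rightarrow>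
   real^'n \<Rightarrow> real^'n \<Rightarrow> 'n \<Rightarrow> real" where
  "coord_prox f \<psi> v \<tau> \<theta> y z i =
     arg_min (\<lambda>u. ereal (gradient f y $ i * (u - y $ i)
                 + \<theta> * real CARD('n) * v $ i / (2 * \<tau>) * \<bar>u - z $ i\<bar>\<^sup>2) + \<psi> i u)
       (\<lambda>_. True)"

definition approx_update ::
  "(real^'n::finite \<Rightarrow> real) \<Rightarrow> ('n \<Rightarrow> real \<Rightarrow> ereal) \<Rightarrow> real^'n \<Rightarrow> real \<Rightarrow> real \<Rightarrow>
   'n set \<Rightarrow> (real^'n) \<times> (real^'n) \<Rightarrow> (real^'n) \<times> (real^'n)" where
  "approx_update f \<psi> v \<tau> \<theta> A = (\<lambda>(x, z).
     let y = (1 - \<theta>) *\<^sub>R x + \<theta> *\<^sub>R z;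
         z' = (\<chi> i. if i \<in> A then coord_prox f \<psi> v \<tau> \<theta> y z i else z $ i);
         x' = y + (real CARD('n) / \<tau> * \<theta>) *\<^sub>R (z' - z)
     in (x', z'))"

text \<open>
  The joint law of the pair \<open>(x_k, z_k)\<close>.  The monadic bind makes each draw from \<open>S\<close> independent
  of the past.
\<close>

primrec approx_state ::
  "(real^'n::finite \<Rightarrow> real) \<Rightarrow> ('n \<Rightarrow> real \<Rightarrow> ereal) \<Rightarrow> real^'n \<Rightarrow> 'n set pmf \<Rightarrow>
   real^'n \<Rightarrow> nat \<Rightarrow> ((real^'n) \<times> (real^'n)) pmf" where
  "approx_state f \<psi> v S x0 0 = return_pmf (x0, x0)"
| "approx_state f \<psi> v S x0 (Suc k) = do {
     s \<leftarrow> approx_state f \<psi> v S x0 k;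
     A \<leftarrow> S;
     return_pmf (approx_update f \<psi> v (avg_size S)
       (theta (avg_size S / real CARD('n)) k) A s)
   }"

definition approx ::
  "(real^'n::finite \<Rightarrow> real) \<Rightarrow> ('n \<Rightarrow> real \<Rightarrow> ereal) \<Rightarrow> real^'n \<Rightarrow> 'n set pmf \<Rightarrow>
   real^'n \<Rightarrow> nat \<Rightarrow> (real^'n) pmf" where
  "approx f \<psi> v S x0 K = map_pmf fst (approx_state f \<psi> v S x0 K)"

primrec approx_restart ::
  "(real^'n::finite \<Rightarrow> real) \<Rightarrow> ('n \<Rightarrow> real \<Rightarrow> ereal) \<Rightarrow> real^'n \<Rightarrow> 'n set pmf \<Rightarrow>
   (nat \<Rightarrow> nat) \<Rightarrow> real^'n \<Rightarrow> nat \<Rightarrow> (real^'n) pmf" where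
  "approx_restart f \<psi> v S K x0 0 = return_pmf x0"
| "approx_restart f \<psi> v S K x0 (Suc r) = do {
     x \<leftarrow> approx_restart f \<psi> v S K x0 r;
     x' \<leftarrow> approx f \<psi> v S x (K r);
     return_pmf (if objective f \<psi> x' \<le> objective f \<psi> x then x' else x)
   }"

section \<open>Sanity checks for the error bound constant\<close>

lemma wnorm_nonneg: "(\<And>i. v $ i > 0) \<Longrightarrow> wnorm v x \<ge> 0"
  unfolding wnorm_def
  by (intro real_sqrt_ge_zero sum_nonneg mult_nonneg_nonneg less_imp_le[of 0 "v $ _"]) auto

lemma wdist_eq_0:
  assumes "\<And>i. v $ i > 0" and "x \<in> A"
  shows "wdist v x A = 0"
proof (rule antisym)
  have bdd: "bdd_below ((\<lambda>y. wnorm v (x - y)) ` A)"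
    using wnorm_nonneg[of v] assms(1) by (auto intro!: bdd_belowI[where m = 0])
  show "wdist v x A \<le> 0"
    using cINF_lower[OF bdd assms(2)] by (simp add: wdist_def wnorm_def)
  show "wdist v x A \<ge> 0"
    using assms wnorm_nonneg[of v] unfolding wdist_def by (intro cINF_greatest) auto
qed

lemma error_bound_const_minimizer:
  assumes "\<And>i. v $ i > 0" and "x0 \<in> minimizers F"
  shows "error_bound_const F v x0 = \<infinity>"
proof -
  have "quadratic_error_bound F v x0 \<mu>" for \<mu>
    unfolding quadratic_error_bound_def
  proof (intro allI impI)
    fix x assume "F x \<le> F x0"
    then have "x \<in> minimizers F"
      using assms(2) order_trans by (fastforce simp: minimizers_def)
    then have "wdist v x (minimizers F) = 0"
      using assms(1) by (rule wdist_eq_0[rotated])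
    then show "min_value F + ereal (\<mu> / 2 * (wdist v x (minimizers F))\<^sup>2) \<le> F x"
      by (simp add: min_value_def INF_lower zero_ereal_def[symmetric])
  qed
  then have Suc: "ereal (real (Suc n)) \<le> error_bound_const F v x0" for n
    unfolding error_bound_const_def by (intro Sup_upper) auto
  have "ereal B \<le> error_bound_const F v x0" for B
  proof -
    obtain n where "B \<le> real n" using real_arch_simple by blast
    then have "ereal B \<le> ereal (real (Suc n))" by simp
    also note Suc
    finally show ?thesis .
  qed
  then show ?thesis
    by (rule ereal_top)
qed

lemma quadratic_error_bound_error_bound_const:
  assumes "\<mu>0 > 0" and "quadratic_error_bound F v x0 \<mu>0"
    and fin: "error_bound_const F v x0 = ereal \<mu>"
  shows "\<mu> > 0" and "quadratic_error_bound F v x0 \<mu>"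
proof -
  let ?M = "{\<mu>. \<mu> > 0 \<and> quadratic_error_bound F v x0 \<mu>}"
  have le: "m \<le> \<mu>" if "m \<in> ?M" for m
    using Sup_upper[of "ereal m" "ereal ` ?M"] that fin by (auto simp: error_bound_const_def)
  show "\<mu> > 0"
    using le[of \<mu>0] assms by auto
  have ap: "\<exists>m\<in>?M. c < m" if "c < \<mu>" for c
    using less_Sup_iff[of "ereal c" "ereal ` ?M"] that fin by (auto simp: error_bound_const_def)
  show "quadratic_error_bound F v x0 \<mu>"
    unfolding quadratic_error_bound_def
  proof (intro allI impI)
    fix x assume x: "F x \<le> F x0"
    define d where "d = (wdist v x (minimizers F))\<^sup>2"
    have bound: "min_value F + ereal (m / 2 * d) \<le> F x" if "m \<in> ?M" for m
      using that x by (auto simp: quadratic_error_bound_def d_def)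
    have inf: "min_value F \<le> F x"
      by (simp add: min_value_def INF_lower)
    show "min_value F + ereal (\<mu> / 2 * (wdist v x (minimizers F))\<^sup>2) \<le> F x"
      unfolding d_def[symmetric]
    proof (cases "min_value F"; cases "F x")
      fix a b assume ab: "min_value F = ereal a" "F x = ereal b"
      have "\<mu> / 2 * d \<le> b - a"
      proof (rule ccontr)
        assume neg: "\<not> \<mu> / 2 * d \<le> b - a"
        moreover have "b - a \<ge> 0" using inf ab by simp
        ultimately have "\<mu> / 2 * d > 0" by linarith
        then have d: "d > 0" using \<open>\<mu> > 0\<close> by (simp add: zero_less_mult_iff)
        then have "2 * (b - a) / d < \<mu>" using neg by (simp add: field_simps)
        then obtain m where m: "m \<in> ?M" "2 * (b - a) / d < m" using ap by blast
        then have "b - a < m / 2 * d" using d by (simp add: field_simps)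
        then show False using bound[OF m(1)] ab by simp
      qed
      then show "min_value F + ereal (\<mu> / 2 * d) \<le> F x" using ab by simp
    qed (use inf in auto)
  qed
qed

end

theory Submission
  imports Defs
begin

text \<open>
  Restarting turns the accelerated rate \<open>O(1 / K\<^sup>2)\<close> of APPROX into a linear one.  One run of \<open>K\<close>
  iterations from \<open>x\<close> satisfies, for every minimizer \<open>w\<close>,
  \<open>E[F x_K - F w] \<le> (\<theta>_(K-1) / \<theta>_0)\<^sup>2 * ((1 - \<theta>_0) (F x - F w) + \<parallel>x - w\<parallel>\<^sub>v\<^sup>2 / 2)\<close> (\<open>approx_bound\<close>).
  Taking the infimum over \<open>w\<close>, the error bound turns the squared distance into a multiple \<open>1 / \<mu>\<close> of
  the gap \<open>F x - F w\<close>, so the run shrinks the expected gap by the factor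
  \<open>(\<theta>_(K-1) / \<theta>_0)\<^sup>2 (1 + \<mu>) / \<mu>\<close>.  Since \<open>1 / \<theta>_k\<close> grows at least like \<open>1 / \<theta>_0 + k / 2\<close>
  (\<open>inverse_theta_ge\<close>), the prescribed period makes this factor at most \<open>\<alpha>\<close>
  (\<open>approx_contraction\<close>).  The guaranteed decrease keeps every restart point in the level set of the
  initial point, so that one and the same \<open>\<mu>\<close> serves all runs, and the contractions multiply
  (\<open>approx_restart_linear\<close>).

  The bound for one run comes from a potential that is a supermartingale.  Its descent inequality
  (\<open>expected_decrease\<close>) combines the expected separable overapproximation, the strong convexity of
  the proximal subproblem (\<open>prox_three_point\<close>) and the gradient inequality for \<open>f\<close>.

  The difficulty is \<open>\<psi>\<close>: it is evaluated at \<open>x_k\<close>, whereas the random block only controls \<open>\<psi>\<close> at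
  \<open>z_k\<close>.  But \<open>x_k\<close> is a convex combination of \<open>z_0, ..., z_k\<close> with deterministic weights, so
  \<open>\<psi> x_k\<close> is at most the same combination \<open>p_k\<close> of the values \<open>\<psi> z_j\<close>, and \<open>p_k\<close> does obey an
  exact recursion in expectation.  The proof therefore carries \<open>p_k\<close> along with the pair
  \<open>(x_k, z_k)\<close> as an additional component of the random state (\<open>surrogate_state\<close>), and replaces
  \<open>F x_k\<close> by \<open>f x_k + p_k\<close> in the potential.
\<close>

section \<open>Gradients of convex functions\<close>

text \<open>
  The definite description in \<^const>\<open>gradient\<close> is justified by representing the derivative, a linear
  functional, as an inner product.
\<close>

lemma GDERIV_gradient:
  fixes f :: "real^'n::finite \<Rightarrow> real"
  assumes "f differentiable (at x)"
  shows "GDERIV f x :> gradient f x"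
proof -
  obtain f' where f': "(f has_derivative f') (at x)"
    using assms unfolding differentiable_def by blast
  then interpret f': linear f'
    by (rule has_derivative_linear)
  obtain D where D: "\<And>h. f' h = h \<bullet> D"
  proof
    fix h :: "real^'n"
    have "f' h = f' (\<Sum>i\<in>UNIV. (h $ i) *\<^sub>R axis i 1)"
      by (simp add: basis_expansion flip: scalar_mult_eq_scaleR)
    also have "\<dots> = h \<bullet> (\<chi> i. f' (axis i 1))"
      by (simp add: f'.sum f'.scaleR inner_vec_def)
    finally show "f' h = h \<bullet> (\<chi> i. f' (axis i 1))" .
  qed
  have "GDERIV f x :> D"
    using f' D unfolding gderiv_def by (metis ext)
  moreover have "D' = D" if "GDERIV f x :> D'" for D'
  proof -
    have "(\<lambda>h. h \<bullet> D') = (\<lambda>h. h \<bullet> D)"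
      using that \<open>GDERIV f x :> D\<close> unfolding gderiv_def by (rule has_derivative_unique)
    then show ?thesis
      by (metis inner_commute vector_eq_ldot)
  qed
  ultimately show ?thesis
    unfolding gradient_def by (rule theI)
qed

text \<open>
  Restriction to the line through \<open>y\<close> and \<open>u\<close> reduces this to the tangent of a convex function of
  one real variable.
\<close>

lemma convex_gradient_inequality:
  fixes f :: "real^'n::finite \<Rightarrow> real"
  assumes "convex_on UNIV f" and "f differentiable (at y)"
  shows "f y + gradient f y \<bullet> (u - y) \<le> f u"
proof -
  define g where "g t = f (y + t *\<^sub>R (u - y))" for t :: real
  have "convex_on UNIV g"
  proof (rule convex_onI)
    fix t a b :: real assume t: "0 < t" "t < 1"
    have "y + ((1 - t) * a + t * b) *\<^sub>R (u - y)
        = (1 - t) *\<^sub>R (y + a *\<^sub>R (u - y)) + t *\<^sub>R (y + b *\<^sub>R (u - y))"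
      by (simp add: algebra_simps)
    then show "g ((1 - t) *\<^sub>R a + t *\<^sub>R b) \<le> (1 - t) * g a + t * g b"
      using convex_onD[OF assms(1), of t] t unfolding g_def by simp
  qed simp
  moreover have "(g has_real_derivative gradient f y \<bullet> (u - y)) (at 0)"
  proof -
    have "((\<lambda>t. y + t *\<^sub>R (u - y)) has_derivative (\<lambda>t. t *\<^sub>R (u - y))) (at 0)"
      by (auto intro!: derivative_eq_intros)
    moreover have "(f has_derivative (\<lambda>h. h \<bullet> gradient f y)) (at (y + 0 *\<^sub>R (u - y)))"
      using GDERIV_gradient[OF assms(2)] by (simp add: gderiv_def)
    ultimately have "(g has_derivative (\<lambda>t. (t *\<^sub>R (u - y)) \<bullet> gradient f y)) (at 0)"
      unfolding g_def using has_derivative_compose by fast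
    then show ?thesis
      by (simp add: has_field_derivative_def inner_commute mult_commute_abs)
  qed
  ultimately have "gradient f y \<bullet> (u - y) * (1 - 0) \<le> g 1 - g 0"
    by (intro convex_on_imp_above_tangent[where A = UNIV]) (auto simp: DERIV_subset)
  then show ?thesis
    by (simp add: g_def)
qed

section \<open>Closed proper convex functions and the proximal step\<close>

lemma closed_proper_convex_real:
  assumes "closed_proper_convex g" and "u \<in> eff_dom g"
  shows "g u = ereal (real_of_ereal (g u))"
  using assms by (cases "g u") (auto simp: closed_proper_convex_def eff_dom_def)

text \<open>
  This connects the extended-valued functions of the problem with the real-valued notion of convexity
  on the effective domain.
\<close>

lemma ereal_epigraph_eq:
  assumes "closed_proper_convex g"
  shows "ereal_epigraph g = epigraph (eff_dom g) (\<lambda>u. real_of_ereal (g u))"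
proof -
  have "g u \<le> ereal t \<longleftrightarrow> u \<in> eff_dom g \<and> real_of_ereal (g u) \<le> t" for u t
    using assms by (cases "g u") (auto simp: closed_proper_convex_def eff_dom_def)
  then show ?thesis
    by (auto simp: ereal_epigraph_def epigraph_def)
qed

lemma closed_proper_convex_convex_on:
  assumes "closed_proper_convex g"
  shows "convex_on (eff_dom g) (\<lambda>u. real_of_ereal (g u))"
  using assms ereal_epigraph_eq[OF assms]
  unfolding convex_epigraph_convex closed_proper_convex_def by metis

text \<open>
  A hyperplane separating the epigraph from a point strictly below the graph cannot be vertical,
  because the point lies under the effective domain; its graph is the minorant.
\<close>

lemma closed_proper_convex_affine_minorant:
  assumes "closed_proper_convex g"
  obtains a b where "\<And>u. ereal (a * u + b) \<le> g u"
proof -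
  obtain u1 where "g u1 \<noteq> \<infinity>"
    using assms by (auto simp: closed_proper_convex_def)
  then obtain t1 where t1: "g u1 = ereal t1"
    using assms by (cases "g u1") (auto simp: closed_proper_convex_def)
  have "(u1, t1 - 1) \<notin> ereal_epigraph g"
    by (simp add: ereal_epigraph_def t1)
  then obtain d :: "real \<times> real" and c where
    d: "d \<bullet> (u1, t1 - 1) < c" "\<And>e. e \<in> ereal_epigraph g \<Longrightarrow> c < d \<bullet> e"
    using separating_hyperplane_closed_point[of "ereal_epigraph g" "(u1, t1 - 1)"] assms
    unfolding closed_proper_convex_def by blast
  obtain p q where pq: "d = (p, q)"
    by (cases d)
  have "c < p * u1 + q * t1"
    using d(2)[of "(u1, t1)"] by (simp add: ereal_epigraph_def t1 pq)
  then have "q > 0"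
    using d(1) by (simp add: pq algebra_simps)
  have "ereal (- (p / q) * u + c / q) \<le> g u" for u
  proof (cases "g u")
    case (real t)
    then have "c < p * u + q * t"
      using d(2)[of "(u, t)"] by (simp add: ereal_epigraph_def pq)
    then show ?thesis
      using \<open>q > 0\<close> real by (simp add: field_simps)
  qed (use assms in \<open>auto simp: closed_proper_convex_def\<close>)
  then show ?thesis
    by (rule that)
qed

lemma quadratic_sublevel_bounded:
  fixes c d e s :: real
  assumes "c > 0" and "c * s\<^sup>2 + d * s + e \<le> 0"
  shows "\<bar>s\<bar> \<le> (\<bar>d\<bar> + \<bar>e\<bar>) / c + 1"
proof (rule ccontr)
  assume "\<not> ?thesis"
  then have s: "\<bar>s\<bar> > (\<bar>d\<bar> + \<bar>e\<bar>) / c + 1" by simp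
  moreover have "(\<bar>d\<bar> + \<bar>e\<bar>) / c \<ge> 0" using assms(1) by simp
  ultimately have s1: "\<bar>s\<bar> > 1" by linarith
  have "c * \<bar>s\<bar> > \<bar>d\<bar> + \<bar>e\<bar>"
    using s assms(1) by (simp add: field_simps)
  then have "c * \<bar>s\<bar> * \<bar>s\<bar> > (\<bar>d\<bar> + \<bar>e\<bar>) * \<bar>s\<bar>"
    using s1 by (intro mult_strict_right_mono) auto
  moreover have "\<bar>e\<bar> * \<bar>s\<bar> \<ge> \<bar>e\<bar>"
    using s1 by (simp add: mult_left_le mult_le_cancel_left1)
  moreover have "d * s \<ge> - (\<bar>d\<bar> * \<bar>s\<bar>)"
    by (metis abs_ge_minus_self abs_mult minus_le_iff)
  moreover have "c * \<bar>s\<bar> * \<bar>s\<bar> = c * s\<^sup>2"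
    by (simp add: power2_eq_square)
  ultimately have "c * s\<^sup>2 + d * s + e > 0"
    unfolding distrib_right by linarith
  then show False using assms(2) by simp
qed

text \<open>
  The quadratic term dominates the affine minorant of \<open>g\<close>, so the part of the epigraph on which the
  subproblem is at most its value at some chosen point of the domain is compact.  Minimizing over the
  epigraph rather than over the line replaces lower semicontinuity of \<open>g\<close> by continuity.
\<close>

lemma prox_exists:
  assumes g: "closed_proper_convex g" and c: "c > 0"
  shows "\<exists>u. \<forall>w. ereal (a * (u - y) + c * \<bar>u - z\<bar>\<^sup>2) + g u
                 \<le> ereal (a * (w - y) + c * \<bar>w - z\<bar>\<^sup>2) + g w"
proof -
  define q where "q u = a * (u - y) + c * \<bar>u - z\<bar>\<^sup>2" for u
  obtain u1 where "g u1 \<noteq> \<infinity>"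
    using g by (auto simp: closed_proper_convex_def)
  then obtain t1 where t1: "g u1 = ereal t1"
    using g by (cases "g u1") (auto simp: closed_proper_convex_def)
  define M where "M = q u1 + t1"
  obtain p b where pb: "\<And>u. ereal (p * u + b) \<le> g u"
    using closed_proper_convex_affine_minorant[OF g] by blast
  define L where "L = ereal_epigraph g \<inter> {e. q (fst e) + snd e \<le> M}"
  have cont: "continuous_on A q" for A
    unfolding q_def by (intro continuous_intros)
  have cont': "continuous_on A (\<lambda>e. q (fst e) + snd e)" for A
    unfolding q_def by (intro continuous_intros)
  have "closed L"
    unfolding L_def using g cont'[of UNIV]
    by (intro closed_Int closed_Collect_le) (auto simp: closed_proper_convex_def)
  moreover have "bounded L"
  proof -
    define R where "R = (\<bar>a + p\<bar> + \<bar>a * (z - y) + p * z + b - M\<bar>) / c + 1"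
    have "bounded ((\<lambda>u. p * u + b) ` cball z R)" "bounded ((\<lambda>u. M - q u) ` cball z R)"
      by (intro compact_imp_bounded compact_continuous_image continuous_intros cont compact_cball)+
    then obtain B1 B2 where
      B: "\<And>u. u \<in> cball z R \<Longrightarrow> \<bar>p * u + b\<bar> \<le> B1" "\<And>u. u \<in> cball z R \<Longrightarrow> \<bar>M - q u\<bar> \<le> B2"
      unfolding bounded_iff by (auto simp del: mem_cball)
    have "e \<in> cball z R \<times> cball 0 (B1 + B2)" if "e \<in> L" for e
    proof -
      obtain u t where e: "e = (u, t)" by (cases e)
      have "ereal (p * u + b) \<le> ereal t"
        using pb[of u] that order_trans by (fastforce simp: L_def e ereal_epigraph_def)
      then have t: "p * u + b \<le> t" "t \<le> M - q u"
        using that by (auto simp: L_def e)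
      then have "c * (u - z)\<^sup>2 + (a + p) * (u - z) + (a * (z - y) + p * z + b - M) \<le> 0"
        by (simp add: q_def algebra_simps)
      from quadratic_sublevel_bounded[OF c this] have u: "u \<in> cball z R"
        by (simp add: R_def dist_real_def abs_minus_commute[of z])
      then show ?thesis
        using B[OF u] t by (auto simp: e dist_real_def)
    qed
    then show ?thesis
      by (intro bounded_subset[OF bounded_Times[OF bounded_cball bounded_cball]]) blast
  qed
  ultimately have "compact L"
    by (simp add: compact_eq_bounded_closed)
  moreover have "(u1, t1) \<in> L"
    by (simp add: L_def ereal_epigraph_def t1 M_def)
  ultimately have "\<exists>e\<in>L. \<forall>e'\<in>L. q (fst e) + snd e \<le> q (fst e') + snd e'"
    by (intro continuous_attains_inf cont') auto
  then obtain e where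
    e: "e \<in> L" "\<And>e'. e' \<in> L \<Longrightarrow> q (fst e) + snd e \<le> q (fst e') + snd e'"
    by auto
  have ge: "g (fst e) \<le> ereal (snd e)"
    using e(1) by (cases e) (auto simp: L_def ereal_epigraph_def)
  have "ereal (q (fst e)) + g (fst e) \<le> ereal (q w) + g w" for w
  proof (cases "g w")
    case (real t)
    have "q (fst e) + snd e \<le> q w + t"
    proof (cases "q w + t \<le> M")
      case True
      then show ?thesis
        using e(2)[of "(w, t)"] by (simp add: L_def ereal_epigraph_def real)
    next
      case False
      then show ?thesis using e(1) by (simp add: L_def)
    qed
    then have "ereal (q (fst e)) + ereal (snd e) \<le> ereal (q w) + g w"
      by (simp add: real)
    then show ?thesis
      using ge add_left_mono order_trans by blast
  qed (use g in \<open>auto simp: closed_proper_convex_def\<close>)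
  then show ?thesis
    unfolding q_def by blast
qed

text \<open>
  The subproblem is strongly convex with modulus \<open>2 * c\<close>, hence grows quadratically away from its
  minimizer \<open>u\<close>.  Comparing \<open>u\<close> with the points of the segment from \<open>u\<close> to \<open>w\<close> and letting them
  tend to \<open>u\<close> gives the growth without differentiating \<open>g\<close>.
\<close>

lemma prox_three_point:
  fixes a c y z u w :: real
  assumes g: "closed_proper_convex g" and w: "w \<in> eff_dom g"
    and min: "\<And>w. ereal (a * (u - y) + c * \<bar>u - z\<bar>\<^sup>2) + g u
                 \<le> ereal (a * (w - y) + c * \<bar>w - z\<bar>\<^sup>2) + g w"
  shows "u \<in> eff_dom g"
    and "a * (u - y) + c * (u - z)\<^sup>2 + real_of_ereal (g u) + c * (w - u)\<^sup>2
       \<le> a * (w - y) + c * (w - z)\<^sup>2 + real_of_ereal (g w)"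
proof -
  let ?g = "\<lambda>u. real_of_ereal (g u)"
  show u: "u \<in> eff_dom g"
    using min[of w] closed_proper_convex_real[OF g w] by (cases "g u") (auto simp: eff_dom_def)
  have min': "a * (u - y) + c * (u - z)\<^sup>2 + ?g u \<le> a * (x - y) + c * (x - z)\<^sup>2 + ?g x"
    if "x \<in> eff_dom g" for x
    using min[of x] closed_proper_convex_real[OF g u] closed_proper_convex_real[OF g that]
    by (metis ereal_less_eq(3) plus_ereal.simps(1) power2_abs)
  have "s * (c * (w - u)\<^sup>2)
      \<le> a * (w - y) + c * (w - z)\<^sup>2 + ?g w - (a * (u - y) + c * (u - z)\<^sup>2 + ?g u)"
    if s: "0 < s" "s < 1" for s
  proof -
    define x where "x = s * u + (1 - s) * w"
    have x: "x \<in> eff_dom g" "?g x \<le> s * ?g u + (1 - s) * ?g w"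
      using closed_proper_convex_convex_on[OF g] s u w
      by (auto simp: x_def convex_on_def convex_def)
    \<comment> \<open>the negative term, the defect of the square from being affine, carries the strong convexity\<close>
    have "(x - z)\<^sup>2 = s * (u - z)\<^sup>2 + (1 - s) * (w - z)\<^sup>2 - s * (1 - s) * (w - u)\<^sup>2"
      by (simp add: x_def power2_eq_square algebra_simps)
    then have "c * (x - z)\<^sup>2 = c * (s * (u - z)\<^sup>2 + (1 - s) * (w - z)\<^sup>2 - s * (1 - s) * (w - u)\<^sup>2)"
      by simp
    moreover have "a * (x - y) = s * (a * (u - y)) + (1 - s) * (a * (w - y))"
      by (simp add: x_def algebra_simps)
    ultimately have "(1 - s) * (s * (c * (w - u)\<^sup>2))
      \<le> (1 - s) * (a * (w - y) + c * (w - z)\<^sup>2 + ?g w - (a * (u - y) + c * (u - z)\<^sup>2 + ?g u))"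
      using min'[OF x(1)] x(2) by (simp add: algebra_simps)
    then show ?thesis
      using s by simp
  qed
  from field_le_mult_one_interval[OF this]
  show "a * (u - y) + c * (u - z)\<^sup>2 + ?g u + c * (w - u)\<^sup>2 \<le> a * (w - y) + c * (w - z)\<^sup>2 + ?g w"
    by simp
qed

text \<open>
  The total weight \<open>a + b\<close> vanishes in the first iteration of APPROX, so the merged point cannot be given
  by a quotient throughout; for zero weight any point of \<open>E\<close> serves.
\<close>

lemma convex_nonneg_combination:
  assumes "convex E" "x \<in> E" "y \<in> E" "0 \<le> a" "0 \<le> b"
  shows "\<exists>e\<in>E. a *\<^sub>R x + b *\<^sub>R y = (a + b) *\<^sub>R e"
proof (cases "a + b = 0")
  case True
  then have "a = 0" "b = 0"
    using assms by linarith+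
  then show ?thesis
    using assms(2) by auto
next
  case False
  then have "a + b > 0" using assms by simp
  then have "(a / (a + b)) *\<^sub>R x + (b / (a + b)) *\<^sub>R y \<in> E"
    using assms by (intro convexD) (auto simp flip: add_divide_distrib)
  moreover have "(a + b) *\<^sub>R ((a / (a + b)) *\<^sub>R x + (b / (a + b)) *\<^sub>R y) = a *\<^sub>R x + b *\<^sub>R y"
    using False by (simp add: scaleR_add_right)
  ultimately show ?thesis
    by metis
qed

section \<open>Step-size parameters\<close>

(* the recursion would otherwise rewrite every later step size into nested square roots *)
declare theta.simps(2) [simp del]

text \<open>
  The recursion picks the positive root of \<open>s\<^sup>2 + t\<^sup>2 s = t\<^sup>2\<close>.  In the form \<open>(1 - s) / s\<^sup>2 = 1 / t\<^sup>2\<close> this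
  is what makes the coefficients of the potential in consecutive iterations match.
\<close>

lemma theta_Suc_square:
  "(theta t0 (Suc k))\<^sup>2 = (1 - theta t0 (Suc k)) * (theta t0 k)\<^sup>2"
proof -
  define t s where "t = theta t0 k" and "s = theta t0 (Suc k)"
  have "2 * s + t\<^sup>2 = sqrt (t ^ 4 + 4 * t\<^sup>2)"
    by (simp add: s_def t_def theta.simps(2) field_simps)
  then have "(2 * s + t\<^sup>2)\<^sup>2 = t ^ 4 + 4 * t\<^sup>2"
    by simp
  then have "4 * s\<^sup>2 = 4 * ((1 - s) * t\<^sup>2)"
    by (simp add: power2_eq_square power4_eq_xxxx algebra_simps)
  then show ?thesis
    by (simp add: s_def t_def)
qed

lemma theta_pos:
  assumes "0 < t0"
  shows "0 < theta t0 k"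
proof (induction k)
  case (Suc k)
  have "sqrt ((theta t0 k) ^ 4) < sqrt (theta t0 k ^ 4 + 4 * (theta t0 k)\<^sup>2)"
    using Suc by simp
  moreover have "sqrt ((theta t0 k) ^ 4) = (theta t0 k)\<^sup>2"
    by (rule real_sqrt_unique) (simp_all flip: power_mult)
  ultimately show ?case
    by (simp add: theta.simps(2))
qed (use assms in simp)

lemma theta_Suc_less_one:
  assumes "0 < t0"
  shows "theta t0 (Suc k) < 1"
proof -
  have "0 < (1 - theta t0 (Suc k)) * (theta t0 k)\<^sup>2"
    using theta_pos[OF assms, of "Suc k"] unfolding theta_Suc_square[symmetric] by simp
  then show ?thesis
    by (simp add: zero_less_mult_iff)
qed

lemma theta_le:
  assumes "0 < t0"
  shows "theta t0 k \<le> t0"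
proof (induction k)
  case (Suc k)
  have "(theta t0 (Suc k))\<^sup>2 \<le> (theta t0 k)\<^sup>2"
    unfolding theta_Suc_square
    using theta_pos[OF assms, of "Suc k"] theta_Suc_less_one[OF assms, of k]
    by (intro mult_left_le_one_le) auto
  then have "theta t0 (Suc k) \<le> theta t0 k"
    using theta_pos[OF assms, of k] by (rule power2_le_imp_le[OF _ less_imp_le])
  then show ?case
    using Suc by linarith
qed simp

text \<open>
  This is the sign of the weight that \<open>z_k\<close> has in \<open>x_(k+1)\<close>; without it \<open>x_(k+1)\<close> would be only an
  affine and not a convex combination of the points \<open>z_j\<close>.
\<close>

lemma theta_Suc_weight:
  assumes "0 < t0" "t0 \<le> 1"
  shows "theta t0 (Suc k) * (1 - t0) \<le> (1 - theta t0 (Suc k)) * theta t0 k"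
proof -
  define t s where "t = theta t0 k" and "s = theta t0 (Suc k)"
  have ts: "0 < t" "0 < s" "s \<le> t0" "s\<^sup>2 = (1 - s) * t\<^sup>2"
    using theta_pos[OF assms(1)] theta_le[OF assms(1)] theta_Suc_square[of t0 k]
    unfolding t_def s_def by blast+
  have "((1 - t0) * t)\<^sup>2 = (1 - t0) * (1 - t0) * t\<^sup>2"
    by (simp add: power2_eq_square)
  also have "\<dots> \<le> (1 - s) * t\<^sup>2"
    using ts assms mult_left_le_one_le[of "1 - t0" "1 - t0"] by (intro mult_right_mono) auto
  finally have "(1 - t0) * t \<le> s"
    using ts by (metis less_imp_le power2_le_imp_le)
  then have "s * ((1 - t0) * t) \<le> s * s"
    using ts by (intro mult_left_mono) auto
  then have "(s * (1 - t0)) * t \<le> ((1 - s) * t) * t"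
    using ts(4) by (simp add: power2_eq_square mult.assoc)
  then have "s * (1 - t0) \<le> (1 - s) * t"
    using ts(1) by (rule mult_right_le_imp_le)
  then show ?thesis
    unfolding t_def s_def .
qed

text \<open>
  Completing the square in \<open>1 / s\<^sup>2 - 1 / s = 1 / t\<^sup>2\<close> shows that each step adds at least \<open>1 / 2\<close> to the
  reciprocal.
\<close>

lemma inverse_theta_ge:
  assumes "0 < t0"
  shows "1 / t0 + k / 2 \<le> 1 / theta t0 k"
proof (induction k)
  case (Suc k)
  define t s where "t = theta t0 k" and "s = theta t0 (Suc k)"
  have ts: "0 < t" "0 < s" "s < 1" "s\<^sup>2 = (1 - s) * t\<^sup>2"
    using theta_pos[OF assms] theta_Suc_less_one[OF assms, of k] theta_Suc_square[of t0 k]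
    unfolding t_def s_def by blast+
  have "(1 / t)\<^sup>2 = 1 / s\<^sup>2 - 1 / s"
    using ts(1-3) by (simp add: ts(4) power_divide divide_simps)
      (use ts(4) in \<open>simp add: power2_eq_square algebra_simps\<close>)
  also have "\<dots> \<le> (1 / s - 1 / 2)\<^sup>2"
    by (simp add: power2_diff power_divide)
  finally have "1 / t \<le> 1 / s - 1 / 2"
    using ts by (auto intro!: power2_le_imp_le[of "1 / t"])
  then show ?case
    using Suc by (simp add: t_def s_def add_divide_distrib)
qed simp

section \<open>Weighted distance and the error bound\<close>

lemma wnorm_square:
  assumes "\<And>i. v $ i > 0"
  shows "(wnorm v x)\<^sup>2 = (\<Sum>i\<in>UNIV. v $ i * (x $ i)\<^sup>2)"
  using assms unfolding wnorm_def
  by (intro real_sqrt_pow2 sum_nonneg mult_nonneg_nonneg) (auto intro: less_imp_le)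

text \<open>
  A bound that holds for all points of a set passes to the distance; this avoids showing that the
  distance is attained.
\<close>

lemma le_wdist_square:
  assumes v: "\<And>i. v $ i > 0" and "A \<noteq> {}" "0 \<le> c"
    and le: "\<And>y. y \<in> A \<Longrightarrow> a \<le> b + c * (wnorm v (x - y))\<^sup>2"
  shows "a \<le> b + c * (wdist v x A)\<^sup>2"
proof (cases "a \<le> b")
  case True
  then show ?thesis
    using assms(3) by (simp add: add_increasing2)
next
  case False
  obtain y where "y \<in> A" using assms(2) by blast
  with le[OF this] False assms(3) have c: "c > 0"
    by (cases "c = 0") auto
  have "sqrt ((a - b) / c) \<le> wnorm v (x - y)" if "y \<in> A" for y
    using le[OF that] c wnorm_nonneg[of v "x - y"] v
    by (intro real_le_lsqrt) (auto simp: field_simps)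
  then have "sqrt ((a - b) / c) \<le> wdist v x A"
    unfolding wdist_def using assms(2) by (intro cINF_greatest)
  then have "(sqrt ((a - b) / c))\<^sup>2 \<le> (wdist v x A)\<^sup>2"
    using False c by (intro power_mono) auto
  then show ?thesis
    using False c by (simp add: field_simps)
qed

text \<open>
  Since \<open>R - 1 = 1 / \<mu>\<close>, with value \<open>0\<close> for \<open>\<mu> = \<infinity>\<close>, the finite and the infinite error bound constant
  are treated uniformly.  In the infinite case the error bound holds with arbitrarily large constants,
  which forces the distance to be zero.
\<close>

lemma error_bound_const_bound:
  assumes F: "local_quadratic_error_bound F v" and x0: "F x0 < \<infinity>"
    and x: "F x \<le> F x0" and vals: "F x = ereal b" "min_value F = ereal a"
  defines "R \<equiv> one_plus_over (error_bound_const F v x0)"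
  shows "(wdist v x (minimizers F))\<^sup>2 / 2 \<le> (R - 1) * (b - a)" and "1 \<le> R"
proof -
  let ?M = "{\<mu>. \<mu> > 0 \<and> quadratic_error_bound F v x0 \<mu>}"
  define d where "d = (wdist v x (minimizers F))\<^sup>2"
  have bound: "m / 2 * d \<le> b - a" if "quadratic_error_bound F v x0 m" for m
    using that x vals unfolding quadratic_error_bound_def d_def[symmetric]
    by (metis add.commute ereal_less_eq(3) le_diff_eq d_def plus_ereal.simps(1))
  obtain \<mu>0 where \<mu>0: "\<mu>0 > 0" "quadratic_error_bound F v x0 \<mu>0"
    using F x0 by (auto simp: local_quadratic_error_bound_def eff_dom_def)
  then have pos: "ereal \<mu>0 \<le> error_bound_const F v x0"
    unfolding error_bound_const_def by (intro Sup_upper) auto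
  have "d / 2 \<le> (R - 1) * (b - a) \<and> 1 \<le> R"
  proof (cases "error_bound_const F v x0")
    case (real \<mu>)
    then have \<mu>: "\<mu> > 0" "quadratic_error_bound F v x0 \<mu>"
      using quadratic_error_bound_error_bound_const[OF \<mu>0] by auto
    have R: "R - 1 = 1 / \<mu>" "1 \<le> R"
      using \<mu>(1) by (simp_all add: R_def one_plus_over_def real field_simps)
    have "d / 2 \<le> 1 / \<mu> * (b - a)"
      using bound[OF \<mu>(2)] \<mu>(1) by (simp add: field_simps)
    with R show ?thesis
      by simp
  next
    case PInf
    then have R: "R = 1"
      by (simp add: R_def one_plus_over_def)
    have "d \<le> 0"
    proof (rule ccontr)
      assume "\<not> d \<le> 0"
      moreover obtain m where "m \<in> ?M" "2 * (b - a) / d < m"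
        using PInf less_Sup_iff[of "ereal (2 * (b - a) / d)" "ereal ` ?M"]
        by (auto simp: error_bound_const_def)
      ultimately show False
        using bound[of m] by (simp add: field_simps)
    qed
    then show ?thesis
      using R by simp
  qed (use pos in auto)
  then show "(wdist v x (minimizers F))\<^sup>2 / 2 \<le> (R - 1) * (b - a)" and "1 \<le> R"
    by (simp_all add: d_def)
qed

section \<open>Uniform samplings\<close>

lemma expectation_coordinate_mixture:
  fixes S :: "'n::finite set pmf" and h :: "'n \<Rightarrow> real \<Rightarrow> real"
  assumes "\<And>i. measure_pmf.prob S {A. i \<in> A} = p"
  shows "measure_pmf.expectation S (\<lambda>A. \<Sum>i\<in>UNIV. h i (if i \<in> A then a i else b i))
       = p * (\<Sum>i\<in>UNIV. h i (a i)) + (1 - p) * (\<Sum>i\<in>UNIV. h i (b i))"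
proof -
  have int: "integrable S g" for g :: "'n set \<Rightarrow> real"
    by (rule integrable_measure_pmf_finite) simp
  have "measure_pmf.expectation S (\<lambda>A. h i (if i \<in> A then a i else b i))
      = p * h i (a i) + (1 - p) * h i (b i)" for i
  proof -
    have "(\<lambda>A. h i (if i \<in> A then a i else b i))
        = (\<lambda>A. indicator {A. i \<in> A} A * (h i (a i) - h i (b i)) + h i (b i))"
      by (auto simp: indicator_def)
    then show ?thesis
      using assms by (simp add: int algebra_simps)
  qed
  then show ?thesis
    by (simp add: int sum.distrib sum_distrib_left)
qed

text \<open>
  The expected size is the sum of the inclusion probabilities, which are all equal.
\<close>

lemma uniform_sampling_prob:
  fixes S :: "'n::finite set pmf"
  assumes "uniform_sampling S"
  shows "measure_pmf.prob S {A. i \<in> A} = avg_size S / real CARD('n)"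
proof -
  have int: "integrable S g" for g :: "'n set \<Rightarrow> real"
    by (rule integrable_measure_pmf_finite) simp
  have "real (card A) = (\<Sum>j\<in>UNIV. indicator {A. j \<in> A} A)" for A :: "'n set"
    by (simp add: indicator_def)
  then have "avg_size S = (\<Sum>j\<in>UNIV. measure_pmf.prob S {A. j \<in> A})"
    unfolding avg_size_def by (simp add: int)
  also have "\<dots> = (\<Sum>j\<in>(UNIV :: 'n set). measure_pmf.prob S {A. i \<in> A})"
    using assms unfolding uniform_sampling_def by (intro sum.cong) auto
  finally show ?thesis
    by simp
qed

lemma restrict_vec_nth: "restrict_vec h A $ i = (if i \<in> A then h $ i else 0)"
proof -
  have "restrict_vec h A $ i = (\<Sum>j\<in>A. if j = i then h $ j else 0)"
    unfolding restrict_vec_def sum_component by (intro sum.cong) (auto simp: axis_def)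
  then show ?thesis
    by simp
qed

section \<open>The composite problem\<close>

locale composite_problem =
  fixes f :: "real^'n::finite \<Rightarrow> real"
    and \<psi> :: "'n \<Rightarrow> real \<Rightarrow> ereal"
    and v :: "real^'n"
    and S :: "'n set pmf"
  assumes f_convex: "convex_on UNIV f"
    and f_differentiable: "\<And>x. f differentiable (at x)"
    and \<psi>_cpc: "\<And>i. closed_proper_convex (\<psi> i)"
    and v_pos: "\<And>i. v $ i > 0"
    and S_uniform: "uniform_sampling S"
    and S_pos: "avg_size S > 0"
    and f_ESO: "ESO f S v"
begin

abbreviation F :: "real^'n \<Rightarrow> ereal" where
  "F \<equiv> objective f \<psi>"

text \<open>
  The first step size \<open>\<theta>_0\<close>, which is also the probability that a given coordinate is sampled.
\<close>

definition t0 :: real where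
  "t0 = avg_size S / real CARD('n)"

text \<open>
  On \<open>domain\<close>, the effective domain of the separable part, the real-valued \<open>G\<close> agrees with
  \<^term>\<open>separable \<psi>\<close>; this keeps extended reals out of the estimates.  \<open>W\<close> is the square of the
  weighted norm.
\<close>

definition domain :: "(real^'n) set" where
  "domain = {x. \<forall>i. x $ i \<in> eff_dom (\<psi> i)}"

definition G :: "real^'n \<Rightarrow> real" where
  "G x = (\<Sum>i\<in>UNIV. real_of_ereal (\<psi> i (x $ i)))"

definition W :: "real^'n \<Rightarrow> real" where
  "W x = (\<Sum>i\<in>UNIV. v $ i * (x $ i)\<^sup>2)"

lemma wnorm_eq_W: "(wnorm v x)\<^sup>2 = W x"
  by (simp add: W_def wnorm_square v_pos)

lemma W_nonneg: "0 \<le> W x"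
  by (metis wnorm_eq_W zero_le_power2)

lemma t0_pos: "0 < t0"
  using S_pos by (simp add: t0_def)

lemma t0_le_1: "t0 \<le> 1"
  using uniform_sampling_prob[OF S_uniform] measure_pmf.prob_le_1 unfolding t0_def by metis

lemma separable_eq: "separable \<psi> x = (if x \<in> domain then ereal (G x) else \<infinity>)"
proof (cases "x \<in> domain")
  case True
  then have "separable \<psi> x = (\<Sum>i\<in>UNIV. ereal (real_of_ereal (\<psi> i (x $ i))))"
    unfolding separable_def domain_def
    using closed_proper_convex_real[OF \<psi>_cpc] by (intro sum.cong) auto
  then show ?thesis
    using True by (simp add: G_def)
next
  case False
  then show ?thesis
    unfolding separable_def domain_def by (auto simp: sum_Pinfty eff_dom_def top.not_eq_extremum)
qed

lemma F_eq: "F x = (if x \<in> domain then ereal (f x + G x) else \<infinity>)"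
  by (simp add: objective_def separable_eq)

lemma convex_epigraph_G: "convex (epigraph domain G)"
proof (rule convex_epigraphI, rule convex_onI)
  have 1: "convex_on (eff_dom (\<psi> i)) (\<lambda>u. real_of_ereal (\<psi> i u))" for i
    by (rule closed_proper_convex_convex_on[OF \<psi>_cpc])
  show "convex domain"
    using 1 unfolding convex_on_def convex_def domain_def by auto
  fix t x y assume t: "0 < t" "t < (1 :: real)" and xy: "x \<in> domain" "y \<in> domain"
  have "G ((1 - t) *\<^sub>R x + t *\<^sub>R y)
      \<le> (\<Sum>i\<in>UNIV. (1 - t) * real_of_ereal (\<psi> i (x $ i)) + t * real_of_ereal (\<psi> i (y $ i)))"
    unfolding G_def using convex_onD[OF 1, of t] t xy
    by (intro sum_mono) (auto simp: domain_def)
  then show "G ((1 - t) *\<^sub>R x + t *\<^sub>R y) \<le> (1 - t) * G x + t * G y"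
    by (simp add: G_def sum.distrib sum_distrib_left)
qed

section \<open>Expected decrease in one iteration\<close>

definition prox :: "real \<Rightarrow> real^'n \<Rightarrow> real^'n \<Rightarrow> real^'n" where
  "prox \<theta> y z = (\<chi> i. coord_prox f \<psi> v (avg_size S) \<theta> y z i)"

lemma coord_prox_minimal:
  assumes "0 < \<theta>"
  shows "ereal (gradient f y $ i * (coord_prox f \<psi> v (avg_size S) \<theta> y z i - y $ i)
             + \<theta> / (2 * t0) * v $ i * \<bar>coord_prox f \<psi> v (avg_size S) \<theta> y z i - z $ i\<bar>\<^sup>2)
           + \<psi> i (coord_prox f \<psi> v (avg_size S) \<theta> y z i)
       \<le> ereal (gradient f y $ i * (w - y $ i) + \<theta> / (2 * t0) * v $ i * \<bar>w - z $ i\<bar>\<^sup>2) + \<psi> i w"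
proof -
  define h where "h u = ereal (gradient f y $ i * (u - y $ i)
    + \<theta> / (2 * t0) * v $ i * \<bar>u - z $ i\<bar>\<^sup>2) + \<psi> i u" for u
  have "coord_prox f \<psi> v (avg_size S) \<theta> y z i = arg_min h (\<lambda>_. True)"
    unfolding coord_prox_def h_def
    by (intro arg_cong[where f = "\<lambda>h. arg_min h (\<lambda>_. True)"] ext) (simp add: t0_def field_simps)
  moreover have "\<theta> / (2 * t0) * v $ i > 0"
    using assms t0_pos v_pos[of i] by simp
  from prox_exists[OF \<psi>_cpc this] have "\<exists>u. is_arg_min h (\<lambda>_. True) u"
    unfolding is_arg_min_linorder h_def by simp
  then have "is_arg_min h (\<lambda>_. True) (arg_min h (\<lambda>_. True))"
    unfolding arg_min_def by (rule someI_ex)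
  ultimately show ?thesis
    unfolding is_arg_min_linorder h_def by simp
qed

lemma prox_in_domain:
  assumes "0 < \<theta>" and "z' \<in> domain"
  shows "prox \<theta> y z \<in> domain"
proof -
  have "coord_prox f \<psi> v (avg_size S) \<theta> y z i \<in> eff_dom (\<psi> i)" for i
    using assms(2) unfolding domain_def
    by (intro prox_three_point(1)[OF \<psi>_cpc _ coord_prox_minimal[OF assms(1)], of "z' $ i"]) auto
  then show ?thesis
    by (simp add: domain_def prox_def)
qed

text \<open>
  The one-dimensional inequalities add up because the subproblem is separable.
\<close>

lemma prox_inequality:
  fixes y z :: "real^'n"
  assumes "0 < \<theta>" and w: "w \<in> domain"
  defines "u \<equiv> prox \<theta> y z"
  shows "gradient f y \<bullet> (u - y) + \<theta> / (2 * t0) * W (u - z) + G u + \<theta> / (2 * t0) * W (w - u)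
       \<le> gradient f y \<bullet> (w - y) + \<theta> / (2 * t0) * W (w - z) + G w"
proof -
  let ?g = "\<lambda>i u. real_of_ereal (\<psi> i u)"
  have "(\<Sum>i\<in>UNIV. gradient f y $ i * (u $ i - y $ i) + \<theta> / (2 * t0) * v $ i * (u $ i - z $ i)\<^sup>2
          + ?g i (u $ i) + \<theta> / (2 * t0) * v $ i * (w $ i - u $ i)\<^sup>2)
      \<le> (\<Sum>i\<in>UNIV. gradient f y $ i * (w $ i - y $ i) + \<theta> / (2 * t0) * v $ i * (w $ i - z $ i)\<^sup>2
          + ?g i (w $ i))"
    using prox_three_point(2)[OF \<psi>_cpc _ coord_prox_minimal[OF assms(1)]] w
    by (intro sum_mono) (simp add: u_def prox_def domain_def)
  then show ?thesis
    by (simp add: inner_vec_def W_def G_def sum.distrib sum_distrib_left mult.assoc)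
qed

definition block_step :: "real \<Rightarrow> real^'n \<Rightarrow> real^'n \<Rightarrow> 'n set \<Rightarrow> real^'n" where
  "block_step \<theta> x z A =
     (\<chi> i. if i \<in> A then prox \<theta> ((1 - \<theta>) *\<^sub>R x + \<theta> *\<^sub>R z) z $ i else z $ i)"

text \<open>
  The factor \<open>n / \<tau>\<close> in the update of \<open>x\<close> is \<open>1 / t0\<close>.
\<close>

lemma approx_update_eq:
  "approx_update f \<psi> v (avg_size S) \<theta> A (x, z) =
     ((1 - \<theta>) *\<^sub>R x + \<theta> *\<^sub>R z + (\<theta> / t0) *\<^sub>R (block_step \<theta> x z A - z), block_step \<theta> x z A)"
  by (simp add: approx_update_def block_step_def prox_def t0_def Let_def mult.commute cong: if_cong)

lemma block_step_in_domain:
  assumes "0 < \<theta>" and "z \<in> domain"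
  shows "block_step \<theta> x z A \<in> domain"
  using prox_in_domain[OF assms, of "(1 - \<theta>) *\<^sub>R x + \<theta> *\<^sub>R z" z] assms(2)
  unfolding block_step_def domain_def by auto

text \<open>
  The update of the surrogate \<open>p\<close> for \<^term>\<open>separable \<psi> x\<close>: the identity
  \<open>x_(k+1) = (1 - \<theta>) x_k - (\<theta> / t0 - \<theta>) z_k + (\<theta> / t0) z_(k+1)\<close> with every point replaced by its
  value.
\<close>

definition surrogate_update :: "real \<Rightarrow> real^'n \<Rightarrow> real \<Rightarrow> real^'n \<Rightarrow> real" where
  "surrogate_update \<theta> z p z' = (1 - \<theta>) * p - (\<theta> / t0 - \<theta>) * G z + \<theta> / t0 * G z'"

text \<open>
  Both \<open>G\<close> and \<open>W\<close> are sums over coordinates, so the expectation of their value after a block step is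
  the \<open>t0\<close>-mixture of the values for the full proximal step \<open>u\<close> and for no step.  In particular the
  expected surrogate is \<open>(1 - \<theta>) p + \<theta> G u\<close>: the value \<open>G z\<close> cancels.  The overapproximation,
  applied to \<open>(\<theta> / t0) (u - z)\<close>, bounds the expectation of \<open>f\<close>; splitting
  \<open>\<theta> (u - z) = \<theta> (u - y) + (1 - \<theta>) (x - y)\<close> leaves the convexity of \<open>f\<close> to absorb the part along
  \<open>x - y\<close>, and the proximal inequality to absorb the part along \<open>u - y\<close>.
\<close>

lemma expected_decrease:
  assumes \<theta>: "0 < \<theta>" "\<theta> \<le> 1" and z: "z \<in> domain" and w: "w \<in> domain"
  shows "measure_pmf.expectation S (\<lambda>A.
           (f (fst (approx_update f \<psi> v (avg_size S) \<theta> A (x, z)))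
             + surrogate_update \<theta> z p (block_step \<theta> x z A) - (f w + G w)) / \<theta>\<^sup>2
           + W (block_step \<theta> x z A - w) / (2 * t0\<^sup>2))
       \<le> (1 - \<theta>) / \<theta>\<^sup>2 * (f x + p - (f w + G w)) + W (z - w) / (2 * t0\<^sup>2)"
proof -
  let ?E = "measure_pmf.expectation S"
  define y where "y = (1 - \<theta>) *\<^sub>R x + \<theta> *\<^sub>R z"
  define u where "u = prox \<theta> y z"
  define g where "g = gradient f y"
  define x' where "x' A = y + restrict_vec ((\<theta> / t0) *\<^sub>R (u - z)) A" for A
  have int [simp]: "integrable S h" for h :: "'n set \<Rightarrow> real"
    by (rule integrable_measure_pmf_finite) simp
  have prob: "measure_pmf.prob S {A. i \<in> A} = t0" for i
    unfolding t0_def by (rule uniform_sampling_prob[OF S_uniform])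
  have x': "fst (approx_update f \<psi> v (avg_size S) \<theta> A (x, z)) = x' A" for A
    unfolding approx_update_eq x'_def fst_conv y_def[symmetric]
    by (auto simp: vec_eq_iff restrict_vec_nth block_step_def u_def y_def[symmetric])
  have block: "block_step \<theta> x z A $ i = (if i \<in> A then u $ i else z $ i)" for A i
    by (simp add: block_step_def u_def y_def)
  have EG: "?E (\<lambda>A. G (block_step \<theta> x z A)) = t0 * G u + (1 - t0) * G z"
    using expectation_coordinate_mixture[OF prob, where h = "\<lambda>i a. real_of_ereal (\<psi> i a)"
        and a = "\<lambda>i. u $ i" and b = "\<lambda>i. z $ i"]
    by (simp add: G_def block)
  have EW: "?E (\<lambda>A. W (block_step \<theta> x z A - w)) = t0 * W (u - w) + (1 - t0) * W (z - w)"
    using expectation_coordinate_mixture[OF prob, where h = "\<lambda>i a. v $ i * (a - w $ i)\<^sup>2"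
        and a = "\<lambda>i. u $ i" and b = "\<lambda>i. z $ i"]
    by (simp add: W_def block)
  have "W (c *\<^sub>R h) = c\<^sup>2 * W h" for c h
    by (simp add: W_def power_mult_distrib sum_distrib_left mult.left_commute)
  moreover have "?E (\<lambda>A. f (x' A)) \<le> f y + t0 * (g \<bullet> ((\<theta> / t0) *\<^sub>R (u - z)) + W ((\<theta> / t0) *\<^sub>R (u - z)) / 2)"
    using f_ESO unfolding ESO_def wnorm_eq_W x'_def g_def t0_def by blast
  ultimately have Ef: "?E (\<lambda>A. f (x' A)) \<le> f y + \<theta> * (g \<bullet> (u - z)) + \<theta> * (\<theta> / (2 * t0) * W (u - z))"
    using t0_pos by (simp add: distrib_left power2_eq_square)
  have "f y + g \<bullet> (x - y) \<le> f x"
    unfolding g_def by (rule convex_gradient_inequality[OF f_convex f_differentiable])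
  then have "(1 - \<theta>) * (f y + g \<bullet> (x - y)) \<le> (1 - \<theta>) * f x"
    using \<theta> by (intro mult_left_mono) auto
  moreover have "\<theta> * (g \<bullet> (u - z)) = \<theta> * (g \<bullet> (u - y)) + (1 - \<theta>) * (g \<bullet> (x - y))"
  proof -
    have "\<theta> *\<^sub>R (u - z) = \<theta> *\<^sub>R (u - y) + (1 - \<theta>) *\<^sub>R (x - y)"
      by (simp add: y_def algebra_simps)
    then show ?thesis
      by (metis inner_add_right inner_scaleR_right)
  qed
  moreover have "\<theta> * (g \<bullet> (u - y) + \<theta> / (2 * t0) * W (u - z) + G u + \<theta> / (2 * t0) * W (w - u))
      \<le> \<theta> * (g \<bullet> (w - y) + \<theta> / (2 * t0) * W (w - z) + G w)"
    unfolding u_def g_def using \<theta> by (intro mult_left_mono prox_inequality w) auto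
  moreover have "\<theta> * (f y + g \<bullet> (w - y)) \<le> \<theta> * f w"
    unfolding g_def using \<theta>
    by (intro mult_left_mono convex_gradient_inequality[OF f_convex f_differentiable]) auto
  ultimately have step: "?E (\<lambda>A. f (x' A)) + (1 - \<theta>) * p + \<theta> * G u
      \<le> (1 - \<theta>) * (f x + p) + \<theta> * (f w + G w) + \<theta>\<^sup>2 / (2 * t0) * (W (w - z) - W (w - u))"
    using Ef by (simp add: algebra_simps power2_eq_square)
  have Ep: "?E (\<lambda>A. surrogate_update \<theta> z p (block_step \<theta> x z A)) = (1 - \<theta>) * p + \<theta> * G u"
    using t0_pos by (simp add: surrogate_update_def EG) (simp add: field_simps)
  have W_sym: "W (a - b) = W (b - a)" for a b
    by (simp add: W_def power2_commute)
  have "?E (\<lambda>A. (f (x' A) + surrogate_update \<theta> z p (block_step \<theta> x z A) - (f w + G w)) / \<theta>\<^sup>2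
           + W (block_step \<theta> x z A - w) / (2 * t0\<^sup>2))
      = (?E (\<lambda>A. f (x' A)) + ((1 - \<theta>) * p + \<theta> * G u) - (f w + G w)) / \<theta>\<^sup>2
        + (t0 * W (u - w) + (1 - t0) * W (z - w)) / (2 * t0\<^sup>2)"
    by (simp add: Ep EW)
  also have "\<dots> \<le> ((1 - \<theta>) * (f x + p - (f w + G w)) + \<theta>\<^sup>2 / (2 * t0) * (W (w - z) - W (w - u))) / \<theta>\<^sup>2
        + (t0 * W (u - w) + (1 - t0) * W (z - w)) / (2 * t0\<^sup>2)"
    using step by (intro add_right_mono divide_right_mono) (auto simp: algebra_simps)
  also have "\<dots> = (1 - \<theta>) / \<theta>\<^sup>2 * (f x + p - (f w + G w)) + W (z - w) / (2 * t0\<^sup>2)"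
    using \<theta> t0_pos unfolding W_sym[of w] add_divide_distrib
    by (simp add: field_simps power2_eq_square)
  finally show ?thesis
    unfolding x' .
qed

section \<open>Iterates as weighted averages of the prox sequence\<close>

text \<open>
  The weight of \<open>z_k\<close> in the representation of \<open>x_k\<close> as a combination of \<open>z_0, ..., z_k\<close>.
\<close>

definition last_weight :: "nat \<Rightarrow> real" where
  "last_weight k = (case k of 0 \<Rightarrow> 1 | Suc j \<Rightarrow> theta t0 j / t0)"

text \<open>
  Only the weight of the latest point \<open>z\<close> matters for the next step, so all the earlier points
  \<open>z_j\<close> are summarized by a single point \<open>e\<close> of the convex epigraph of \<open>G\<close>.
\<close>

definition valid_surrogate :: "nat \<Rightarrow> ((real^'n) \<times> (real^'n)) \<times> real \<Rightarrow> bool" where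
  "valid_surrogate k = (\<lambda>((x, z), p). z \<in> domain \<and> (\<exists>e\<in>epigraph domain G.
     (x, p) = last_weight k *\<^sub>R (z, G z) + (1 - last_weight k) *\<^sub>R e))"

lemma last_weight_bounds: "0 \<le> last_weight k" "last_weight k \<le> 1"
  using theta_pos[OF t0_pos] theta_le[OF t0_pos] t0_pos
  by (auto simp: last_weight_def less_imp_le split: nat.split)

text \<open>
  The pair \<open>(x, p)\<close> is a convex combination of points of the epigraph of \<open>G\<close>, so it lies there itself.
\<close>

lemma valid_surrogate_bound:
  assumes "valid_surrogate k ((x, z), p)"
  shows "x \<in> domain" "G x \<le> p"
proof -
  obtain e where "z \<in> domain" "e \<in> epigraph domain G"
    "(x, p) = last_weight k *\<^sub>R (z, G z) + (1 - last_weight k) *\<^sub>R e"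
    using assms by (auto simp: valid_surrogate_def)
  moreover from this have "(z, G z) \<in> epigraph domain G"
    by (simp add: epigraph_def)
  ultimately have "(x, p) \<in> epigraph domain G"
    using last_weight_bounds[of k] convexD[OF convex_epigraph_G, of "(z, G z)" e] by simp
  then show "x \<in> domain" "G x \<le> p"
    by (auto simp: epigraph_def)
qed

text \<open>
  The new pair gives weight \<open>\<theta> / t0\<close> to \<open>z'\<close>, weight \<open>a = (1 - \<theta>) \<gamma> - (\<theta> / t0 - \<theta>)\<close> to \<open>z\<close> and
  weight \<open>b = (1 - \<theta>) (1 - \<gamma>)\<close> to \<open>e\<close>; the last two are nonnegative and merge into one point.
\<close>

lemma valid_surrogate_step:
  assumes cert: "valid_surrogate k ((x, z), p)" and z': "z' \<in> domain"
  defines "\<theta> \<equiv> theta t0 k"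
  shows "valid_surrogate (Suc k)
    (((1 - \<theta>) *\<^sub>R x + \<theta> *\<^sub>R z + (\<theta> / t0) *\<^sub>R (z' - z), z'), surrogate_update \<theta> z p z')"
proof -
  define \<gamma> where "\<gamma> = last_weight k"
  define a where "a = (1 - \<theta>) * \<gamma> - (\<theta> / t0 - \<theta>)"
  define b where "b = (1 - \<theta>) * (1 - \<gamma>)"
  obtain e where z: "z \<in> domain" and e: "e \<in> epigraph domain G"
    and xp: "(x, p) = \<gamma> *\<^sub>R (z, G z) + (1 - \<gamma>) *\<^sub>R e"
    using cert by (auto simp: valid_surrogate_def \<gamma>_def)
  have \<theta>: "0 < \<theta>" "\<theta> \<le> 1"
    using theta_pos[OF t0_pos] theta_le[OF t0_pos, of k] t0_le_1 by (auto simp: \<theta>_def)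
  have "0 \<le> a"
  proof (cases k)
    case 0
    then show ?thesis
      using t0_pos by (simp add: a_def \<gamma>_def \<theta>_def last_weight_def)
  next
    case (Suc j)
    have "0 \<le> ((1 - theta t0 (Suc j)) * theta t0 j - theta t0 (Suc j) * (1 - t0)) / t0"
      using theta_Suc_weight[OF t0_pos t0_le_1, of j] t0_pos by simp
    also have "\<dots> = a"
      using t0_pos Suc by (simp add: a_def \<gamma>_def \<theta>_def last_weight_def field_simps)
    finally show ?thesis .
  qed
  moreover have "0 \<le> b"
    using \<theta> last_weight_bounds[of k] by (simp add: b_def \<gamma>_def)
  moreover have "(z, G z) \<in> epigraph domain G"
    using z by (simp add: epigraph_def)
  ultimately obtain e' where e': "e' \<in> epigraph domain G"
    "a *\<^sub>R (z, G z) + b *\<^sub>R e = (a + b) *\<^sub>R e'"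
    using convex_nonneg_combination[OF convex_epigraph_G _ e] by blast
  have "((1 - \<theta>) *\<^sub>R x + \<theta> *\<^sub>R z + (\<theta> / t0) *\<^sub>R (z' - z), surrogate_update \<theta> z p z')
      = (1 - \<theta>) *\<^sub>R (x, p) - (\<theta> / t0 - \<theta>) *\<^sub>R (z, G z) + (\<theta> / t0) *\<^sub>R (z', G z')"
    by (simp add: surrogate_update_def algebra_simps)
  also have "\<dots> = (\<theta> / t0) *\<^sub>R (z', G z') + (a *\<^sub>R (z, G z) + b *\<^sub>R e)"
    unfolding xp a_def b_def
    by (simp add: algebra_simps del: scaleR_Pair add_Pair diff_Pair)
  also have "\<dots> = (\<theta> / t0) *\<^sub>R (z', G z') + (1 - \<theta> / t0) *\<^sub>R e'"
    unfolding e'(2) by (simp add: a_def b_def algebra_simps)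
  finally show ?thesis
    using z' e'(1) by (auto simp: valid_surrogate_def last_weight_def \<theta>_def)
qed

definition surrogate_step ::
  "real \<Rightarrow> ((real^'n) \<times> (real^'n)) \<times> real \<Rightarrow> 'n set \<Rightarrow> ((real^'n) \<times> (real^'n)) \<times> real" where
  "surrogate_step \<theta> = (\<lambda>((x, z), p) A.
     (approx_update f \<psi> v (avg_size S) \<theta> A (x, z), surrogate_update \<theta> z p (block_step \<theta> x z A)))"

primrec surrogate_state :: "real^'n \<Rightarrow> nat \<Rightarrow> (((real^'n) \<times> (real^'n)) \<times> real) pmf" where
  "surrogate_state x0 0 = return_pmf ((x0, x0), G x0)"
| "surrogate_state x0 (Suc k) = surrogate_state x0 k \<bind> (\<lambda>s. map_pmf (surrogate_step (theta t0 k) s) S)"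

lemma map_fst_surrogate_state: "map_pmf fst (surrogate_state x0 k) = approx_state f \<psi> v S x0 k"
proof (induction k)
  case (Suc k)
  show ?case
    by (simp add: map_bind_pmf bind_map_pmf map_pmf_comp surrogate_step_def split_beta
        flip: Suc.IH map_pmf_def t0_def)
qed simp

lemma surrogate_state_valid:
  assumes "x0 \<in> domain" and "s \<in> set_pmf (surrogate_state x0 k)"
  shows "valid_surrogate k s"
  using assms(2)
proof (induction k arbitrary: s)
  case 0
  then show ?case
    using assms(1) by (auto simp: valid_surrogate_def last_weight_def epigraph_def)
next
  case (Suc k)
  then obtain x z p A where s: "((x, z), p) \<in> set_pmf (surrogate_state x0 k)"
    "s = surrogate_step (theta t0 k) ((x, z), p) A"
    by auto
  have cert: "valid_surrogate k ((x, z), p)"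
    by (rule Suc.IH[OF s(1)])
  then have "block_step (theta t0 k) x z A \<in> domain"
    by (intro block_step_in_domain theta_pos t0_pos) (simp add: valid_surrogate_def)
  from valid_surrogate_step[OF cert this] show ?case
    by (simp add: s(2) surrogate_step_def approx_update_eq)
qed

section \<open>The potential is a supermartingale\<close>

definition potential :: "nat \<Rightarrow> real^'n \<Rightarrow> ((real^'n) \<times> (real^'n)) \<times> real \<Rightarrow> real" where
  "potential k w = (\<lambda>((x, z), p).
     (1 - theta t0 k) / (theta t0 k)\<^sup>2 * (f x + p - (f w + G w)) + W (z - w) / (2 * t0\<^sup>2))"

text \<open>
  Both sides of the descent inequality become instances of one potential: its coefficient
  \<open>(1 - \<theta>_(k+1)) / \<theta>_(k+1)\<^sup>2\<close> equals \<open>1 / \<theta>_k\<^sup>2\<close>.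
\<close>

lemma potential_Suc:
  "potential (Suc k) w ((x, z), p) =
     (f x + p - (f w + G w)) / (theta t0 k)\<^sup>2 + W (z - w) / (2 * t0\<^sup>2)"
proof -
  have "(1 - theta t0 (Suc k)) / (theta t0 (Suc k))\<^sup>2 = 1 / (theta t0 k)\<^sup>2"
    using theta_pos[OF t0_pos, of k] theta_Suc_less_one[OF t0_pos, of k]
    by (simp add: theta_Suc_square)
  then show ?thesis
    by (simp add: potential_def)
qed

lemma minimizer_in_domain:
  assumes "w \<in> minimizers F" and "x \<in> domain"
  shows "w \<in> domain" "f w + G w \<le> f x + G x" "min_value F = ereal (f w + G w)"
proof -
  have "F w \<le> F y" for y
    using assms(1) by (simp add: minimizers_def)
  from this[of x] show w: "w \<in> domain" "f w + G w \<le> f x + G x"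
    using assms(2) by (auto simp: F_eq split: if_splits)
  have "min_value F = F w"
    unfolding min_value_def using \<open>\<And>y. F w \<le> F y\<close> by (intro antisym INF_lower INF_greatest) auto
  then show "min_value F = ereal (f w + G w)"
    using w by (simp add: F_eq)
qed

lemma potential_nonneg:
  assumes "w \<in> minimizers F" and "valid_surrogate k s"
  shows "0 \<le> potential k w s"
proof -
  obtain x z p where s: "s = ((x, z), p)"
    by (metis prod.exhaust)
  have "0 \<le> f x + p - (f w + G w)"
    using valid_surrogate_bound[OF assms(2)[unfolded s]] minimizer_in_domain(2)[OF assms(1), of x] by simp
  moreover have "theta t0 k \<le> 1"
    using theta_le[OF t0_pos, of k] t0_le_1 by linarith
  ultimately show ?thesis
    unfolding potential_def s by (simp add: W_nonneg)
qed

text \<open>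
  The tower property with the one-step decrease, applied conditionally on the state.  Minimality of
  \<open>w\<close> makes the potential nonnegative, which allows nonnegative integrals throughout.
\<close>

lemma potential_supermartingale:
  assumes w: "w \<in> minimizers F" and x0: "x0 \<in> domain"
  shows "(\<integral>\<^sup>+s. ennreal (potential k w s) \<partial>surrogate_state x0 k)
       \<le> ennreal (potential 0 w ((x0, x0), G x0))"
proof (induction k)
  case (Suc k)
  define \<theta> where "\<theta> = theta t0 k"
  have \<theta>: "0 < \<theta>" "\<theta> \<le> 1"
    using theta_pos[OF t0_pos] theta_le[OF t0_pos, of k] t0_le_1 by (auto simp: \<theta>_def)
  have "(\<integral>\<^sup>+A. ennreal (potential (Suc k) w (surrogate_step \<theta> s A)) \<partial>S) \<le> ennreal (potential k w s)"
    if s: "s \<in> set_pmf (surrogate_state x0 k)" for s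
  proof -
    obtain x z p where s_eq: "s = ((x, z), p)"
      by (metis prod.exhaust)
    have "valid_surrogate (Suc k) (surrogate_step \<theta> s A)" if "A \<in> set_pmf S" for A
      using s that by (intro surrogate_state_valid[OF x0]) (auto simp: \<theta>_def)
    then have "(\<integral>\<^sup>+A. ennreal (potential (Suc k) w (surrogate_step \<theta> s A)) \<partial>S)
        = ennreal (measure_pmf.expectation S (\<lambda>A. potential (Suc k) w (surrogate_step \<theta> s A)))"
      by (intro nn_integral_eq_integral integrable_measure_pmf_finite)
         (auto simp: AE_measure_pmf_iff intro: potential_nonneg[OF w])
    also have "\<dots> \<le> ennreal (potential k w s)"
    proof (rule ennreal_leI)
      have z: "z \<in> domain"
        using surrogate_state_valid[OF x0 s] by (simp add: s_eq valid_surrogate_def)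
      have w_dom: "w \<in> domain"
        by (rule minimizer_in_domain(1)[OF w x0])
      have "potential k w s = (1 - \<theta>) / \<theta>\<^sup>2 * (f x + p - (f w + G w)) + W (z - w) / (2 * t0\<^sup>2)"
        by (simp add: potential_def s_eq \<theta>_def)
      then show "measure_pmf.expectation S (\<lambda>A. potential (Suc k) w (surrogate_step \<theta> s A)) \<le> potential k w s"
        using expected_decrease[OF \<theta> z w_dom, of x p]
        by (simp add: s_eq surrogate_step_def approx_update_eq potential_Suc flip: \<theta>_def)
    qed
    finally show ?thesis .
  qed
  then have "(\<integral>\<^sup>+s. ennreal (potential (Suc k) w s) \<partial>surrogate_state x0 (Suc k))
      \<le> (\<integral>\<^sup>+s. ennreal (potential k w s) \<partial>surrogate_state x0 k)"
    by (auto simp flip: \<theta>_def intro!: nn_integral_mono_AE simp: AE_measure_pmf_iff)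
  also note Suc.IH
  finally show ?case .
qed simp

text \<open>
  After \<open>m + 1\<close> iterations the gap is at most \<open>\<theta>_m\<^sup>2\<close> times the potential, whose expectation does not
  exceed the initial potential.
\<close>

lemma approx_bound:
  assumes w: "w \<in> minimizers F" and x0: "x0 \<in> domain"
  shows "(\<integral>\<^sup>+x. e2ennreal (F x - min_value F) \<partial>approx f \<psi> v S x0 (Suc m))
       \<le> ennreal ((theta t0 m / t0)\<^sup>2 * ((1 - t0) * (f x0 + G x0 - (f w + G w)) + W (x0 - w) / 2))"
proof -
  define \<theta> where "\<theta> = theta t0 m"
  have \<theta>: "0 < \<theta>"
    using theta_pos[OF t0_pos] by (simp add: \<theta>_def)
  have "(\<integral>\<^sup>+x. e2ennreal (F x - min_value F) \<partial>approx f \<psi> v S x0 (Suc m))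
      = (\<integral>\<^sup>+s. e2ennreal (F (fst (fst s)) - min_value F) \<partial>surrogate_state x0 (Suc m))"
    unfolding approx_def map_fst_surrogate_state[symmetric] nn_integral_map_pmf ..
  also have "\<dots> \<le> (\<integral>\<^sup>+s. ennreal (\<theta>\<^sup>2) * ennreal (potential (Suc m) w s) \<partial>surrogate_state x0 (Suc m))"
  proof (rule nn_integral_mono_AE, unfold AE_measure_pmf_iff, rule ballI)
    fix s assume s: "s \<in> set_pmf (surrogate_state x0 (Suc m))"
    obtain x z p where s_eq: "s = ((x, z), p)"
      by (metis prod.exhaust)
    have x: "x \<in> domain" "G x \<le> p"
      using valid_surrogate_bound surrogate_state_valid[OF x0 s] unfolding s_eq by blast+
    have "f x + G x - (f w + G w) \<le> \<theta>\<^sup>2 * ((f x + p - (f w + G w)) / \<theta>\<^sup>2 + W (z - w) / (2 * t0\<^sup>2))"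
      using x \<theta> by (simp add: distrib_left W_nonneg add_increasing2)
    then show "e2ennreal (F (fst (fst s)) - min_value F) \<le> ennreal (\<theta>\<^sup>2) * ennreal (potential (Suc m) w s)"
      using x by (simp add: s_eq F_eq minimizer_in_domain(3)[OF w x0] potential_Suc \<theta>_def
          ennreal_leI flip: ennreal_mult')
  qed
  also have "\<dots> = ennreal (\<theta>\<^sup>2) * (\<integral>\<^sup>+s. ennreal (potential (Suc m) w s) \<partial>surrogate_state x0 (Suc m))"
    by (rule nn_integral_cmult) simp
  also have "\<dots> \<le> ennreal (\<theta>\<^sup>2) * ennreal (potential 0 w ((x0, x0), G x0))"
    by (intro mult_left_mono potential_supermartingale w x0) simp
  also have "\<dots> = ennreal (\<theta>\<^sup>2 * potential 0 w ((x0, x0), G x0))"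
    by (simp add: ennreal_mult')
  also have "\<theta>\<^sup>2 * potential 0 w ((x0, x0), G x0)
      = (\<theta> / t0)\<^sup>2 * ((1 - t0) * (f x0 + G x0 - (f w + G w)) + W (x0 - w) / 2)"
    using t0_pos by (simp add: potential_def power_divide field_simps)
  finally show ?thesis
    unfolding \<theta>_def .
qed

section \<open>Restarting\<close>

definition restart_period :: "real \<Rightarrow> real^'n \<Rightarrow> nat" where
  "restart_period \<alpha> x0 =
     nat \<lceil>2 / t0 * (sqrt (one_plus_over (error_bound_const F v x0) / \<alpha>) - 1) + 1\<rceil>"

text \<open>
  Here \<open>R = (1 + \<mu>) / \<mu>\<close> for the constant of the level set of \<open>x0\<close>, which contains \<open>x\<close>.  The bound
  for one run with the error bound gives the factor \<open>c (1 - t0 + (R - 1)) \<le> c R\<close>, where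
  \<open>c = (\<theta>_m / t0)\<^sup>2\<close> and \<open>m\<close> is one less than the period.
\<close>

lemma approx_contraction:
  assumes min: "minimizers F \<noteq> {}" and F: "local_quadratic_error_bound F v"
    and x0: "x0 \<in> domain" and x: "F x \<le> F x0" and \<alpha>: "0 < \<alpha>" "\<alpha> < 1"
  shows "(\<integral>\<^sup>+y. e2ennreal (F y - min_value F) \<partial>approx f \<psi> v S x (restart_period \<alpha> x0))
       \<le> ennreal \<alpha> * e2ennreal (F x - min_value F)"
proof -
  let ?I = "\<integral>\<^sup>+y. e2ennreal (F y - min_value F) \<partial>approx f \<psi> v S x (restart_period \<alpha> x0)"
  have x_dom: "x \<in> domain"
    using x x0 by (auto simp: F_eq split: if_splits)
  obtain w0 where w0: "w0 \<in> minimizers F"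
    using min by blast
  define Fs where "Fs = f w0 + G w0"
  have Fs: "min_value F = ereal Fs" "Fs \<le> f x + G x"
    using minimizer_in_domain[OF w0 x_dom] by (auto simp: Fs_def)
  define \<Delta> where "\<Delta> = f x + G x - Fs"
  have \<Delta>: "0 \<le> \<Delta>" "F x - min_value F = ereal \<Delta>"
    using Fs x_dom by (simp_all add: \<Delta>_def F_eq)
  define R where "R = one_plus_over (error_bound_const F v x0)"
  have R: "(wdist v x (minimizers F))\<^sup>2 / 2 \<le> (R - 1) * \<Delta>" "1 \<le> R"
    using error_bound_const_bound[OF F _ x _ Fs(1), of "f x + G x"] x0 x_dom
    by (simp_all add: F_eq R_def \<Delta>_def)
  define s where "s = sqrt (R / \<alpha>)"
  have s: "1 < s" "s\<^sup>2 = R / \<alpha>"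
    using R(2) \<alpha> by (simp_all add: s_def field_simps)
  have K: "2 / t0 * (s - 1) + 1 \<le> real (restart_period \<alpha> x0)"
    unfolding restart_period_def s_def R_def by (rule real_nat_ceiling_ge)
  have "0 < 2 / t0 * (s - 1)"
    using s t0_pos by simp
  then have "0 < restart_period \<alpha> x0"
    using K by linarith
  then obtain m where m: "restart_period \<alpha> x0 = Suc m"
    by (metis gr0_implies_Suc)
  define c where "c = (theta t0 m / t0)\<^sup>2"
  have "c * R \<le> \<alpha>"
  proof -
    \<comment> \<open>this inequality is what the formula for the period encodes: \<open>m \<ge> (2 / t0) (s - 1)\<close>\<close>
    have "s / t0 \<le> 1 / t0 + m / 2"
      using K m t0_pos by (simp add: field_simps)
    also have "\<dots> \<le> 1 / theta t0 m"
      by (rule inverse_theta_ge[OF t0_pos])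
    finally have "theta t0 m / t0 * s \<le> 1"
      using theta_pos[OF t0_pos, of m] t0_pos by (simp add: field_simps)
    then have "(theta t0 m / t0 * s)\<^sup>2 \<le> 1"
      using theta_pos[OF t0_pos, of m] t0_pos s by (intro power_le_one) auto
    then have "c * (R / \<alpha>) \<le> 1"
      by (simp add: c_def power_mult_distrib power_divide s(2)[symmetric] del: times_divide_eq_right)
    then show ?thesis
      using \<alpha> by (simp add: field_simps)
  qed
  have bound: "?I \<le> ennreal (c * (1 - t0) * \<Delta> + c / 2 * (wnorm v (x - w))\<^sup>2)" if "w \<in> minimizers F" for w
  proof -
    have "f w + G w = Fs"
      using minimizer_in_domain(3)[OF that x_dom] Fs(1) by simp
    then show ?thesis
      using approx_bound[OF that x_dom, of m] by (simp add: m c_def wnorm_eq_W \<Delta>_def algebra_simps)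
  qed
  then have "?I < top"
    using w0 by (meson ennreal_less_top order_le_less_trans)
  then obtain e where e: "?I = ennreal e" "0 \<le> e"
    by (metis ennreal_enn2real_if enn2real_nonneg less_irrefl)
  have c: "0 \<le> c"
    by (simp add: c_def)
  have "e \<le> c * (1 - t0) * \<Delta> + c / 2 * (wnorm v (x - w))\<^sup>2" if "w \<in> minimizers F" for w
  proof -
    have nonneg: "0 \<le> c * (1 - t0) * \<Delta> + c / 2 * (wnorm v (x - w))\<^sup>2"
      using c \<Delta>(1) t0_le_1 by simp
    show ?thesis
      using bound[OF that] unfolding e(1) ennreal_le_iff[OF nonneg] .
  qed
  from le_wdist_square[OF v_pos min _ this] c
  have "e \<le> c * (1 - t0) * \<Delta> + c / 2 * (wdist v x (minimizers F))\<^sup>2"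
    by simp
  also have "\<dots> \<le> c * (1 - t0) * \<Delta> + c * ((R - 1) * \<Delta>)"
    using mult_left_mono[OF R(1) c] by simp
  also have "\<dots> = c * R * \<Delta> - c * t0 * \<Delta>"
    by (simp add: algebra_simps)
  also have "\<dots> \<le> c * R * \<Delta>"
    using c t0_pos \<Delta>(1) by simp
  also have "\<dots> \<le> \<alpha> * \<Delta>"
    using \<open>c * R \<le> \<alpha>\<close> \<Delta>(1) by (rule mult_right_mono)
  finally show ?thesis
    using \<alpha> \<Delta> by (simp add: e ennreal_leI flip: ennreal_mult')
qed

lemma approx_restart_le:
  assumes "x \<in> set_pmf (approx_restart f \<psi> v S K x0 r)"
  shows "F x \<le> F x0"
  using assms by (induction r arbitrary: x) (auto split: if_splits intro: order_trans)

text \<open>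
  The accepted point is the better of the old point and the outcome of the run, so its gap is at most
  that of the outcome and each restart inherits the contraction.
\<close>

theorem approx_restart_linear:
  assumes min: "minimizers F \<noteq> {}" and F: "local_quadratic_error_bound F v"
    and x0: "x0 \<in> domain" and \<alpha>: "0 < \<alpha>" "\<alpha> < 1"
  shows "(\<integral>\<^sup>+x. e2ennreal (F x - min_value F) \<partial>approx_restart f \<psi> v S (\<lambda>_. restart_period \<alpha> x0) x0 r)
       \<le> ennreal (\<alpha> ^ r) * e2ennreal (F x0 - min_value F)"
proof (induction r)
  case (Suc r)
  let ?gap = "\<lambda>x. e2ennreal (F x - min_value F)"
  let ?M = "approx_restart f \<psi> v S (\<lambda>_. restart_period \<alpha> x0) x0"
  have "(\<integral>\<^sup>+x. ?gap x \<partial>?M (Suc r))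
      = (\<integral>\<^sup>+x. \<integral>\<^sup>+y. ?gap (if F y \<le> F x then y else x) \<partial>approx f \<psi> v S x (restart_period \<alpha> x0) \<partial>?M r)"
    by simp
  also have "\<dots> \<le> (\<integral>\<^sup>+x. \<integral>\<^sup>+y. ?gap y \<partial>approx f \<psi> v S x (restart_period \<alpha> x0) \<partial>?M r)"
    by (intro nn_integral_mono e2ennreal_mono ereal_minus_mono) auto
  also have "\<dots> \<le> (\<integral>\<^sup>+x. ennreal \<alpha> * ?gap x \<partial>?M r)"
    using approx_contraction[OF min F x0 approx_restart_le \<alpha>]
    by (intro nn_integral_mono_AE) (simp add: AE_measure_pmf_iff)
  also have "\<dots> = ennreal \<alpha> * (\<integral>\<^sup>+x. ?gap x \<partial>?M r)"
    by (rule nn_integral_cmult) simp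
  also have "\<dots> \<le> ennreal \<alpha> * (ennreal (\<alpha> ^ r) * ?gap x0)"
    by (intro mult_left_mono Suc.IH) simp
  also have "\<dots> = ennreal (\<alpha> ^ Suc r) * ?gap x0"
    using \<alpha> by (simp add: ennreal_mult mult.assoc)
  finally show ?case .
qed simp

end

theorem corollary1:
  fixes f :: "real^'n::finite \<Rightarrow> real"
    and \<psi> :: "'n \<Rightarrow> real \<Rightarrow> ereal"
    and v x0 :: "real^'n"
    and S :: "'n set pmf"
    and F :: "real^'n \<Rightarrow> ereal"
    and \<theta>0 \<alpha> :: real
    and K r :: nat
  assumes "convex_on UNIV f"
    and "\<And>x. f differentiable (at x)"
    and "\<And>i. closed_proper_convex (\<psi> i)"
    and "F = objective f \<psi>"
    and "minimizers F \<noteq> {}"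
    and "\<And>i. v $ i > 0"
    and "local_quadratic_error_bound F v"
    and "uniform_sampling S"
    and "avg_size S > 0"
    and "ESO f S v"
    and "x0 \<in> eff_dom (separable \<psi>)"
    and "\<theta>0 = avg_size S / real CARD('n)"
    and "0 < \<alpha>" and "\<alpha> < 1"
    and "K = nat \<lceil>2 / \<theta>0 * (sqrt (one_plus_over (error_bound_const F v x0) / \<alpha>) - 1) + 1\<rceil>"
  shows "(\<integral>\<^sup>+x. e2ennreal (F x - min_value F) \<partial>measure_pmf (approx_restart f \<psi> v S (\<lambda>_. K) x0 r))
           \<le> ennreal (\<alpha> ^ r) * e2ennreal (F x0 - min_value F)"
proof -
  interpret composite_problem f \<psi> v S
    using assms(1-3,6,8-10) by unfold_locales
  have "x0 \<in> domain"
    using assms(11) by (simp add: eff_dom_def separable_eq split: if_splits)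
  moreover have "K = restart_period \<alpha> x0"
    using assms(4,12,15) by (simp add: restart_period_def t0_def)
  ultimately show ?thesis
    using approx_restart_linear assms(4,5,7,13,14) by simp
qed

end
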